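(* Let $\mathcal G$ be a connected groupoid, $x\in\mathcal G_0$, $\tau(x)=\{\tau_y\}_{y\in\mathcal G_0}$ a transversal for $x$ and $A$ a ring. The lifted partial action $\beta=(B_g,\beta_g)_{g\in\mathcal G}$ of $\mathcal G$ on $A$ coming from a datum $(I,\gamma_{\tau(x)},\gamma_{(x)})$ in $\mathcal D_{\tau(x)}(A)$ is $\tau(x)$-global if and only if $I_{\tau_y^{-1}}=I_x$ and $I_{\tau_y}=I_y$ for all $y\in\mathcal G_0$.
   Context: Conventions. Rings are associative, not necessarily unital; ideals are two-sided. A groupoid $\mathcal G$ is a small category in which every morphism is invertible; it is identified with its set of morphisms, and its set of objects $\mathcal G_0$ is identified with the set of identity morphisms. For $g\in\mathcal G$, $s(g)=g^{-1}g$ and $t(g)=gg^{-1}$; $gh$ is defined iff $s(g)=t(h)$. Put $\mathcal G(y,z)=\{g: s(g)=y,\ t(g)=z\}$ and $\mathcal G(x)=\mathcal G(x,x)$ (a group). $\mathcal G$ is connected if $\mathcal G(y,z)\neq\emptyset$ for all $y,z\in\mathcal G_0$. A transversal for $x$ is a family $\tau(x)=\{\tau_y: y\in\mathcal G_0\}$ with $\tau_y\in\mathcal G(x,y)$ and $\tau_x=x$. Put $g_x=\tau_{t(g)}^{-1}g\tau_{s(g)}\in\mathcal G(x)$. For partial bijections, $u\circ v$ has domain $v^{-1}(\mathrm{dom}(u)\cap\mathrm{ran}(v))$ and range $u(\mathrm{dom}(u)\cap\mathrm{ran}(v))$. A partial action of a groupoid $\mathcal G$ on a ring $A$ is a family $\alpha=(A_g,\alpha_g)_{g\in\mathcal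 G}$ where, for each $g$, $A_{t(g)}$ is an ideal of $A$, $A_g$ is an ideal of $A_{t(g)}$, $\alpha_g:A_{g^{-1}}\to A_g$ is a ring isomorphism, $\alpha_y=\mathrm{id}_{A_y}$ for $y\in\mathcal G_0$, and $\alpha_{gh}$ extends $\alpha_g\circ\alpha_h$ whenever $s(g)=t(h)$. A partial action of a group $H$ on a ring $R$ is the one-object case with the ideal attached to the identity equal to $R$. The partial action $\alpha$ is $\tau(x)$-global if $A_{\tau_y^{-1}}=A_x$ and $A_{\tau_y}=A_y$ for all $y\in\mathcal G_0$. An object of $\mathcal D_{\tau(x)}(A)$ is a datum $(I,\gamma_{\tau(x)},\gamma_{(x)})$ consisting of: (a) a family $I=\{I_y\}_{y\in\mathcal G_0}$ of ideals of $A$; (b) ring isomorphisms $\gamma_{\tau(x)}=\{\gamma_{\tau_y}:I_{\tau_y^{-1}}\to I_{\tau_y}\}_{y\in\mathcal G_0}$; (c) a partial action $\gamma_{(x)}=(I_h,\gamma_h)_{h\in\mathcal G(x)}$ of the group $\mathcal G(x)$ on $I_x$; such that (d) $\gamma_x=\gamma_{\tau_x}$ is the identity map of $I_x=I_{\tau_x}$; (e) $I_{\tau_y}$ is an ideal of $I_y$ and $I_{\tau_y^{-1}}$ is an ideal of $I_x$ for all $y$; (f) $\gamma_{\tau_{t(g)}}\big(I_{\tau_{t(g)}^{-1}}\cap\gamma_{g_x}(I_{\tau_{s(g)}^{-1}}\cap I_{g_x^{-1}})\big)$ is an ideal of $I_{t(g)}$ for all $g\in\mathcal G$. The lifted partial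 action coming from it is $\beta=(B_g,\beta_g)_{g\in\mathcal G}$ with $\beta_y=\mathrm{id}_{I_y}$ for $y\in\mathcal G_0$, $\beta_g=\gamma_{\tau_{t(g)}}\circ\gamma_{g_x}\circ\gamma_{\tau_{s(g)}}^{-1}$ for $g\notin\mathcal G_0$ (composition of partial bijections), and $B_g$ the range of $\beta_g$; it is a partial action of $\mathcal G$ on $A$. *)

theory Defs
  imports Main
begin

section \<open>Groupoids\<close>

text \<open>Small categories in arrows-only form: an object is identified with its identity morphism,
  so source and target are themselves morphisms.  The field \<open>Comp\<close> is total, but
  \<open>Comp G g h\<close> is only meaningful when \<open>Src G g = Tgt G h\<close>.\<close>

record 'g arrows =
  Mor :: "'g set"
  Src :: "'g \<Rightarrow> 'g"
  Tgt :: "'g \<Rightarrow> 'g"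
  Comp :: "'g \<Rightarrow> 'g \<Rightarrow> 'g"

definition small_category :: "'g arrows \<Rightarrow> bool" where
  "small_category G \<longleftrightarrow>
     (\<forall>g \<in> Mor G. Src G g \<in> Mor G \<and> Tgt G g \<in> Mor G \<and>
        Src G (Src G g) = Src G g \<and> Tgt G (Src G g) = Src G g \<and>
        Src G (Tgt G g) = Tgt G g \<and> Tgt G (Tgt G g) = Tgt G g) \<and>
     (\<forall>g \<in> Mor G. \<forall>h \<in> Mor G. Src G g = Tgt G h \<longrightarrow>
        Comp G g h \<in> Mor G \<and> Src G (Comp G g h) = Src G h \<and> Tgt G (Comp G g h) = Tgt G g) \<and>
     (\<forall>g \<in> Mor G. \<forall>h \<in> Mor G. \<forall>k \<in> Mor G. Src G g = Tgt G h \<longrightarrow> Src G h = Tgt G k \<longrightarrow>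
        Comp G (Comp G g h) k = Comp G g (Comp G h k)) \<and>
     (\<forall>g \<in> Mor G. Comp G (Tgt G g) g = g \<and> Comp G g (Src G g) = g)"

definition inverse_in :: "'g arrows \<Rightarrow> 'g \<Rightarrow> 'g \<Rightarrow> bool" where
  "inverse_in G g h \<longleftrightarrow> h \<in> Mor G \<and> Src G h = Tgt G g \<and> Tgt G h = Src G g \<and>
     Comp G h g = Src G g \<and> Comp G g h = Tgt G g"

definition groupoid :: "'g arrows \<Rightarrow> bool" where
  "groupoid G \<longleftrightarrow> small_category G \<and> (\<forall>g \<in> Mor G. \<exists>h. inverse_in G g h)"

definition Inv :: "'g arrows \<Rightarrow> 'g \<Rightarrow> 'g" where
  "Inv G g = (THE h. inverse_in G g h)"

definition Obj :: "'g arrows \<Rightarrow> 'g set" where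
  "Obj G = {e \<in> Mor G. Src G e = e}"

definition Hom :: "'g arrows \<Rightarrow> 'g \<Rightarrow> 'g \<Rightarrow> 'g set" where
  "Hom G y z = {g \<in> Mor G. Src G g = y \<and> Tgt G g = z}"

text \<open>The group of endomorphisms of \<open>x\<close>, viewed as a groupoid with the single object \<open>x\<close>.\<close>

definition isotropy :: "'g arrows \<Rightarrow> 'g \<Rightarrow> 'g arrows" where
  "isotropy G x = G\<lparr>Mor := Hom G x x\<rparr>"

definition connected_groupoid :: "'g arrows \<Rightarrow> bool" where
  "connected_groupoid G \<longleftrightarrow> groupoid G \<and> (\<forall>y \<in> Obj G. \<forall>z \<in> Obj G. Hom G y z \<noteq> {})"

definition transversal :: "'g arrows \<Rightarrow> 'g \<Rightarrow> ('g \<Rightarrow> 'g) \<Rightarrow> bool" where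
  "transversal G x \<tau> \<longleftrightarrow> (\<forall>y \<in> Obj G. \<tau> y \<in> Hom G x y) \<and> \<tau> x = x"

text \<open>The element \<open>g\<^sub>x\<close> of the isotropy group at \<open>x\<close> determined by \<open>g\<close> and the transversal.\<close>

definition to_isotropy :: "'g arrows \<Rightarrow> ('g \<Rightarrow> 'g) \<Rightarrow> 'g \<Rightarrow> 'g" where
  "to_isotropy G \<tau> g = Comp G (Comp G (Inv G (\<tau> (Tgt G g))) g) (\<tau> (Src G g))"

lemma
  assumes "small_category G" "g \<in> Mor G"
  shows Comp_Tgt: "Comp G (Tgt G g) g = g" and Comp_Src: "Comp G g (Src G g) = g"
  using assms unfolding small_category_def by blast+

lemma Comp_closed:
  assumes "small_category G" "g \<in> Mor G" "h \<in> Mor G" "Src G g = Tgt G h"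
  shows "Comp G g h \<in> Mor G \<and> Src G (Comp G g h) = Src G h \<and> Tgt G (Comp G g h) = Tgt G g"
  using assms unfolding small_category_def by blast

lemma Comp_assoc:
  assumes "small_category G" "g \<in> Mor G" "h \<in> Mor G" "k \<in> Mor G"
    "Src G g = Tgt G h" "Src G h = Tgt G k"
  shows "Comp G (Comp G g h) k = Comp G g (Comp G h k)"
  using assms unfolding small_category_def by blast

lemma inverse_in_unique:
  assumes C: "small_category G" and g: "g \<in> Mor G"
    and h: "inverse_in G g h" and k: "inverse_in G g k"
  shows "h = k"
proof -
  note h = h[unfolded inverse_in_def] and k = k[unfolded inverse_in_def]
  have "h = Comp G h (Comp G g k)"
    using Comp_Src[OF C, of h] h k by simp
  also have "\<dots> = Comp G (Comp G h g) k"
    using Comp_assoc[OF C, of h g k] g h k by simp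
  also have "\<dots> = k"
    using Comp_Tgt[OF C, of k] h k by simp
  finally show ?thesis .
qed

lemma inverse_in_Inv:
  assumes "groupoid G" "g \<in> Mor G"
  shows "inverse_in G g (Inv G g)"
proof -
  have "\<exists>h. inverse_in G g h" and C: "small_category G"
    using assms unfolding groupoid_def by blast+
  then have "\<exists>!h. inverse_in G g h"
    using inverse_in_unique[OF C assms(2)] by blast
  then show ?thesis
    unfolding Inv_def by (rule theI')
qed

lemma
  assumes "groupoid G" "g \<in> Mor G"
  shows Src_eq: "Src G g = Comp G (Inv G g) g" and Tgt_eq: "Tgt G g = Comp G g (Inv G g)"
  using inverse_in_Inv[OF assms] by (simp_all add: inverse_in_def)

lemma groupoid_isotropy:
  assumes "groupoid G" "x \<in> Obj G"
  shows "groupoid (isotropy G x)" and "Obj (isotropy G x) = {x}"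
proof -
  have x: "x \<in> Mor G" "Src G x = x"
    using assms(2) by (simp_all add: Obj_def)
  have C: "small_category G"
    using assms(1) by (simp add: groupoid_def)
  have "Tgt G (Src G x) = Src G x"
    using C x(1) unfolding small_category_def by blast
  then have Tx: "Tgt G x = x"
    by (simp add: x)
  have "small_category (isotropy G x)"
    using x Tx Comp_Tgt[OF C] Comp_Src[OF C] Comp_assoc[OF C] Comp_closed[OF C]
    by (auto simp: small_category_def isotropy_def Hom_def) metis
  moreover have "\<exists>h. inverse_in (isotropy G x) g h" if "g \<in> Hom G x x" for g
  proof -
    have g: "g \<in> Mor G" "Src G g = x" "Tgt G g = x" using that by (auto simp: Hom_def)
    have "inverse_in (isotropy G x) g (Inv G g)"
      using inverse_in_Inv[OF assms(1) g(1)] g by (simp add: inverse_in_def isotropy_def Hom_def)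
    then show ?thesis ..
  qed
  ultimately show "groupoid (isotropy G x)"
    unfolding groupoid_def by (simp add: isotropy_def)
  show "Obj (isotropy G x) = {x}"
    using x Tx by (auto simp: Obj_def isotropy_def Hom_def)
qed


section \<open>Rings, ideals and partial ring isomorphisms\<close>

text \<open>Rings are not assumed unital (class \<^class>\<open>ring\<close>) and are given by carrier sets, because
  ideals also play the role of the ring acted upon.\<close>

definition subrng :: "'a::ring set \<Rightarrow> bool" where
  "subrng R \<longleftrightarrow> 0 \<in> R \<and> (\<forall>a \<in> R. \<forall>b \<in> R. a - b \<in> R \<and> a * b \<in> R)"

definition ideal_of :: "'a::ring set \<Rightarrow> 'a set \<Rightarrow> bool" where
  "ideal_of J R \<longleftrightarrow> J \<subseteq> R \<and> 0 \<in> J \<and> (\<forall>a \<in> J. \<forall>b \<in> J. a - b \<in> J) \<and>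
     (\<forall>r \<in> R. \<forall>a \<in> J. r * a \<in> J \<and> a * r \<in> J)"

text \<open>Partial bijections are injective maps of type \<^typ>\<open>'a \<Rightarrow> 'a option\<close>; domain, range, composition
  and extension are \<^const>\<open>dom\<close>, \<^const>\<open>ran\<close>, \<^const>\<open>map_comp\<close> and \<^const>\<open>map_le\<close>.\<close>

definition id_map :: "'a set \<Rightarrow> 'a \<rightharpoonup> 'a" where
  "id_map S = Some |` S"

definition inv_map :: "('a \<rightharpoonup> 'a) \<Rightarrow> 'a \<rightharpoonup> 'a" where
  "inv_map u = (\<lambda>b. if b \<in> ran u then Some (THE a. u a = Some b) else None)"

definition image_map :: "('a \<rightharpoonup> 'a) \<Rightarrow> 'a set \<Rightarrow> 'a set" where
  "image_map u S = ran (u |` S)"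

definition ring_iso_map :: "('a::ring \<rightharpoonup> 'a) \<Rightarrow> 'a set \<Rightarrow> 'a set \<Rightarrow> bool" where
  "ring_iso_map u S T \<longleftrightarrow> dom u = S \<and> ran u = T \<and> inj_on u S \<and>
     (\<forall>a \<in> S. \<forall>b \<in> S. the (u (a + b)) = the (u a) + the (u b) \<and>
                      the (u (a * b)) = the (u a) * the (u b))"


section \<open>Partial actions\<close>

definition partial_action ::
  "'g arrows \<Rightarrow> 'a::ring set \<Rightarrow> ('g \<Rightarrow> 'a set) \<Rightarrow> ('g \<Rightarrow> 'a \<rightharpoonup> 'a) \<Rightarrow> bool" where
  "partial_action G R A \<alpha> \<longleftrightarrow>
     (\<forall>g \<in> Mor G. ideal_of (A (Tgt G g)) R \<and> ideal_of (A g) (A (Tgt G g)) \<and>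
        ring_iso_map (\<alpha> g) (A (Inv G g)) (A g)) \<and>
     (\<forall>y \<in> Obj G. \<alpha> y = id_map (A y)) \<and>
     (\<forall>g \<in> Mor G. \<forall>h \<in> Mor G. Src G g = Tgt G h \<longrightarrow> (\<alpha> g \<circ>\<^sub>m \<alpha> h) \<subseteq>\<^sub>m \<alpha> (Comp G g h))"

definition group_partial_action ::
  "'g arrows \<Rightarrow> 'g \<Rightarrow> 'a::ring set \<Rightarrow> ('g \<Rightarrow> 'a set) \<Rightarrow> ('g \<Rightarrow> 'a \<rightharpoonup> 'a) \<Rightarrow> bool" where
  "group_partial_action H e R A \<alpha> \<longleftrightarrow> Obj H = {e} \<and> partial_action H R A \<alpha> \<and> A e = R"

text \<open>A condition on the domains of a partial action; the maps do not enter.\<close>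

definition tau_global :: "'g arrows \<Rightarrow> 'g \<Rightarrow> ('g \<Rightarrow> 'g) \<Rightarrow> ('g \<Rightarrow> 'a set) \<Rightarrow> bool" where
  "tau_global G x \<tau> A \<longleftrightarrow> (\<forall>y \<in> Obj G. A (Inv G (\<tau> y)) = A x \<and> A (\<tau> y) = A y)"


section \<open>Lifting data\<close>

text \<open>\<open>obj_ideal y\<close> is \<open>I\<^sub>y\<close>.  The map \<open>tau_map y\<close> belongs to the morphism \<open>\<tau>\<^sub>y\<close> and goes from
  \<open>tau_dom y\<close> (the ideal indexed by the inverse of \<open>\<tau>\<^sub>y\<close>) to \<open>tau_ran y\<close> (the ideal indexed by
  \<open>\<tau>\<^sub>y\<close>).  \<open>iso_ideal h\<close>, \<open>iso_map h\<close> are \<open>I\<^sub>h\<close>, \<open>\<gamma>\<^sub>h\<close> for \<open>h\<close> in the isotropy group at \<open>x\<close>.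
  The three index sets only meet in \<open>x = \<tau>\<^sub>x\<close>, where the fields are required to agree.\<close>

record ('g, 'a) datum =
  obj_ideal :: "'g \<Rightarrow> 'a set"
  tau_dom :: "'g \<Rightarrow> 'a set"
  tau_ran :: "'g \<Rightarrow> 'a set"
  tau_map :: "'g \<Rightarrow> 'a \<rightharpoonup> 'a"
  iso_ideal :: "'g \<Rightarrow> 'a set"
  iso_map :: "'g \<Rightarrow> 'a \<rightharpoonup> 'a"

definition lifting_datum ::
  "'g arrows \<Rightarrow> 'g \<Rightarrow> ('g \<Rightarrow> 'g) \<Rightarrow> 'a::ring set \<Rightarrow> ('g, 'a) datum \<Rightarrow> bool" where
  "lifting_datum G x \<tau> A D \<longleftrightarrow>
     (\<forall>y \<in> Obj G. ideal_of (obj_ideal D y) A) \<and>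
     (\<forall>y \<in> Obj G. ring_iso_map (tau_map D y) (tau_dom D y) (tau_ran D y)) \<and>
     group_partial_action (isotropy G x) x (obj_ideal D x) (iso_ideal D) (iso_map D) \<and>
     tau_ran D x = obj_ideal D x \<and>
     tau_map D x = id_map (obj_ideal D x) \<and> iso_map D x = id_map (obj_ideal D x) \<and>
     (\<forall>y \<in> Obj G. ideal_of (tau_ran D y) (obj_ideal D y) \<and>
        ideal_of (tau_dom D y) (obj_ideal D x)) \<and>
     (\<forall>g \<in> Mor G. ideal_of
        (image_map (tau_map D (Tgt G g))
          (tau_dom D (Tgt G g) \<inter>
           image_map (iso_map D (to_isotropy G \<tau> g))
             (tau_dom D (Src G g) \<inter> iso_ideal D (Inv G (to_isotropy G \<tau> g)))))
        (obj_ideal D (Tgt G g)))"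

definition lift_map :: "'g arrows \<Rightarrow> ('g \<Rightarrow> 'g) \<Rightarrow> ('g, 'a) datum \<Rightarrow> 'g \<Rightarrow> 'a \<rightharpoonup> 'a" where
  "lift_map G \<tau> D g =
     (if g \<in> Obj G then id_map (obj_ideal D g)
      else tau_map D (Tgt G g) \<circ>\<^sub>m iso_map D (to_isotropy G \<tau> g) \<circ>\<^sub>m inv_map (tau_map D (Src G g)))"

definition lift_ideal :: "'g arrows \<Rightarrow> ('g \<Rightarrow> 'g) \<Rightarrow> ('g, 'a) datum \<Rightarrow> 'g \<Rightarrow> 'a set" where
  "lift_ideal G \<tau> D g = ran (lift_map G \<tau> D g)"

end

theory Submission
  imports Defs
begin

text \<open>Both \<open>(\<tau>\<^sub>y)\<^sub>x\<close> and \<open>(\<tau>\<^sub>y\<inverse>)\<^sub>x\<close> are the identity \<open>x\<close>, and \<open>\<gamma>\<^sub>x\<close> is the identity of \<open>I\<^sub>x\<close>, so the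
  lifted map at \<open>\<tau>\<^sub>y\<close> is \<open>\<gamma>\<close> at \<open>\<tau>\<^sub>y\<close>, and at \<open>\<tau>\<^sub>y\<inverse>\<close> it is the inverse of that map. Hence the lifted ideals
  at \<open>\<tau>\<^sub>y\<close>, \<open>\<tau>\<^sub>y\<inverse>\<close> and \<open>y\<close> are exactly the ideals of the datum, and the two conditions coincide.\<close>

lemma id_map_apply: "id_map S a = (if a \<in> S then Some a else None)"
  by (simp add: id_map_def restrict_map_def)

lemma dom_id_map [simp]: "dom (id_map S) = S"
  by (auto simp: id_map_apply dom_def)

lemma ran_id_map [simp]: "ran (id_map S) = S"
  by (auto simp: id_map_apply ran_def)

lemma id_map_comp: "ran u \<subseteq> S \<Longrightarrow> id_map S \<circ>\<^sub>m u = u"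
  by (rule ext) (auto simp: map_comp_def id_map_apply ran_def split: option.splits)

lemma comp_id_map: "dom u \<subseteq> S \<Longrightarrow> u \<circ>\<^sub>m id_map S = u"
proof
  fix a
  assume "dom u \<subseteq> S"
  then show "(u \<circ>\<^sub>m id_map S) a = u a"
    by (cases "u a") (auto simp: map_comp_def id_map_apply)
qed

lemma inv_map_id_map: "inv_map (id_map S) = id_map S"
  by (rule ext) (auto simp: inv_map_def id_map_apply ran_def intro!: the_equality)

text \<open>Injectivity makes the description inside \<open>inv_map\<close> pick the actual
  preimage, so every point of \<open>dom u\<close> is hit. This is what brings
  \<open>tau_dom\<close> back as a range.\<close>

lemma ran_inv_map:
  assumes "inj_on u (dom u)"
  shows "ran (inv_map u) = dom u"
proof -
  have preimage: "(THE a. u a = Some b) = a" if "u a = Some b" for a b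
    using assms that by (intro the_equality) (auto simp: inj_on_def dom_def)
  show ?thesis
  proof
    show "ran (inv_map u) \<subseteq> dom u"
      using preimage by (auto simp: ran_def inv_map_def split: if_splits)
    show "dom u \<subseteq> ran (inv_map u)"
    proof
      fix a assume "a \<in> dom u"
      then obtain b where b: "u a = Some b" by blast
      then have "inv_map u b = Some a"
        using preimage by (auto simp: inv_map_def ran_def)
      then show "a \<in> ran (inv_map u)" by (rule ranI)
    qed
  qed
qed

lemma
  assumes "groupoid G" "x \<in> Obj G"
  shows Obj_Mor: "x \<in> Mor G" and Src_Obj: "Src G x = x" and Tgt_Obj: "Tgt G x = x"
    and Comp_Obj: "Comp G x x = x" and Inv_Obj: "Inv G x = x"
proof -
  have C: "small_category G"
    using assms(1) by (simp add: groupoid_def)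
  show x: "x \<in> Mor G" "Src G x = x"
    using assms(2) by (simp_all add: Obj_def)
  have "Tgt G (Src G x) = Src G x"
    using C x(1) unfolding small_category_def by blast
  then show t: "Tgt G x = x" by (simp add: x)
  show c: "Comp G x x = x"
    using Comp_Src[OF C x(1)] by (simp add: x)
  \<comment> \<open>An identity is its own inverse; uniqueness of inverses then determines
    \<open>Inv G x\<close>.\<close>
  have "inverse_in G x x"
    by (simp add: inverse_in_def x t c)
  then show "Inv G x = x"
    using inverse_in_unique[OF C x(1) inverse_in_Inv[OF assms(1) x(1)]] by simp
qed

text \<open>As \<open>\<tau> y\<close> runs from \<open>x\<close> to \<open>y\<close> and
  \<open>\<tau> x = x\<close>, the two products are \<open>Inv G (\<tau> y)\<close> times
  \<open>\<tau> y\<close> with an identity factor \<open>x\<close> on the right or on the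
  left.\<close>

lemma
  assumes G: "groupoid G" and x: "x \<in> Obj G" and T: "transversal G x \<tau>" and y: "y \<in> Obj G"
  shows to_isotropy_transversal: "to_isotropy G \<tau> (\<tau> y) = x"
    and to_isotropy_Inv_transversal: "to_isotropy G \<tau> (Inv G (\<tau> y)) = x"
proof -
  have \<tau>: "\<tau> y \<in> Mor G" "Src G (\<tau> y) = x" "Tgt G (\<tau> y) = y" "\<tau> x = x"
    using T y by (auto simp: transversal_def Hom_def)
  note i = inverse_in_Inv[OF G \<tau>(1), unfolded inverse_in_def]
  have C: "small_category G"
    using G by (simp add: groupoid_def)
  show "to_isotropy G \<tau> (\<tau> y) = x"
    using i by (simp add: to_isotropy_def \<tau> Comp_Obj[OF G x])
  show "to_isotropy G \<tau> (Inv G (\<tau> y)) = x"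
    using i Comp_Tgt[OF C, of "Inv G (\<tau> y)"] by (simp add: to_isotropy_def \<tau> Inv_Obj[OF G x])
qed

lemma lift_ideal_Obj: "y \<in> Obj G \<Longrightarrow> lift_ideal G \<tau> D y = obj_ideal D y"
  by (simp add: lift_ideal_def lift_map_def)

lemma
  assumes G: "groupoid G" and x: "x \<in> Obj G" and T: "transversal G x \<tau>"
    and D: "lifting_datum G x \<tau> A D" and y: "y \<in> Obj G"
  shows lift_ideal_transversal: "lift_ideal G \<tau> D (\<tau> y) = tau_ran D y"
    and lift_ideal_Inv_transversal: "lift_ideal G \<tau> D (Inv G (\<tau> y)) = tau_dom D y"
proof -
  have \<tau>: "\<tau> y \<in> Mor G" "Src G (\<tau> y) = x" "Tgt G (\<tau> y) = y" "\<tau> x = x"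
    using T y by (auto simp: transversal_def Hom_def)
  note i = inverse_in_Inv[OF G \<tau>(1), unfolded inverse_in_def]
  have iso: "dom (tau_map D z) = tau_dom D z" "ran (tau_map D z) = tau_ran D z"
      "inj_on (tau_map D z) (dom (tau_map D z))" if "z \<in> Obj G" for z
    using D that by (auto simp: lifting_datum_def ring_iso_map_def)
  have sub: "tau_dom D y \<subseteq> obj_ideal D x"
    using D y by (auto simp: lifting_datum_def ideal_of_def)
  have at_x: "tau_map D x = id_map (obj_ideal D x)" "iso_map D x = id_map (obj_ideal D x)"
      "tau_ran D x = obj_ideal D x"
    using D by (auto simp: lifting_datum_def)
  have "lift_ideal G \<tau> D (\<tau> y) = tau_ran D y \<and> lift_ideal G \<tau> D (Inv G (\<tau> y)) = tau_dom D y"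
  \<comment> \<open>At objects \<open>lift_map\<close> uses a separate clause, and
    \<open>\<tau> y\<close> is an object only for \<open>y = x\<close>.\<close>
  proof (cases "y = x")
    case True
    \<comment> \<open>Read off from the domain of the identity \<open>tau_map D x\<close>.\<close>
    have "tau_dom D x = obj_ideal D x"
      using iso(1)[OF x] by (simp add: at_x)
    then show ?thesis
      using True by (simp add: \<tau>(4) Inv_Obj[OF G x] lift_ideal_Obj[OF x] at_x)
  next
    case False
    \<comment> \<open>An object has equal source and target, but here these are \<open>x\<close> and
      \<open>y\<close>.\<close>
    have "\<tau> y \<notin> Obj G"
      using False Src_Obj[OF G] Tgt_Obj[OF G] \<tau>(2,3) by metis
    \<comment> \<open>The two right factors are identities of \<open>obj_ideal D x\<close>; they
      cancel because it contains \<open>tau_dom D y\<close>.\<close>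
    then have "lift_map G \<tau> D (\<tau> y) = tau_map D y"
      using iso[OF y] sub
      by (simp add: lift_map_def to_isotropy_transversal[OF G x T y] \<tau> at_x inv_map_id_map comp_id_map)
    moreover have "Inv G (\<tau> y) \<notin> Obj G"
      using False i Src_Obj[OF G] Tgt_Obj[OF G] \<tau>(2,3) by metis
    \<comment> \<open>Now the identities stand on the left, so the range of the inverse, again
      \<open>tau_dom D y\<close>, must lie in \<open>obj_ideal D x\<close>.\<close>
    then have "lift_map G \<tau> D (Inv G (\<tau> y)) = inv_map (tau_map D y)"
      using i iso[OF y] sub
      by (simp add: lift_map_def to_isotropy_Inv_transversal[OF G x T y] \<tau> at_x id_map_comp ran_inv_map)
    ultimately show ?thesis
      using iso[OF y] by (simp add: lift_ideal_def ran_inv_map)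
  qed
  then show "lift_ideal G \<tau> D (\<tau> y) = tau_ran D y"
    and "lift_ideal G \<tau> D (Inv G (\<tau> y)) = tau_dom D y" by simp_all
qed

theorem proposition5p5:
  fixes G :: "'g arrows" and x :: 'g and \<tau> :: "'g \<Rightarrow> 'g"
    and A :: "'a::ring set" and D :: "('g, 'a) datum"
  assumes "connected_groupoid G"
    and "x \<in> Obj G"
    and "transversal G x \<tau>"
    and "subrng A"
    and "lifting_datum G x \<tau> A D"
  shows "tau_global G x \<tau> (lift_ideal G \<tau> D) \<longleftrightarrow>
    (\<forall>y \<in> Obj G. tau_dom D y = obj_ideal D x \<and> tau_ran D y = obj_ideal D y)"
proof -
  have G: "groupoid G"
    using assms(1) by (simp add: connected_groupoid_def)
  show ?thesis
    unfolding tau_global_def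
    by (simp add: lift_ideal_transversal[OF G assms(2,3,5)] lift_ideal_Obj assms(2)
        lift_ideal_Inv_transversal[OF G assms(2,3,5)])
qed

end
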